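(* Assume that the optimal solution set of the second-order cone program (P): maximize $c^{\top}x$ subject to $Ax=b$, $x\in\mathcal{K}$, is nonempty and compact. Let $\{x^{(k)}\}_{k\ge 0}$ be an infinite sequence generated by the adaptive LP-Newton (ALPN) method applied to (P). Then any accumulation point of $\{x^{(k)}\}$ is an optimal solution of (P).
   Context: Problem. Let $A\in\mathbb{R}^{m\times n}$, $b\in\mathbb{R}^{m}$, $c\in\mathbb{R}^{n}$, and $\mathcal{K}=\mathcal{K}^{n_1}\times\cdots\times\mathcal{K}^{n_p}$ with $n_1+\dots+n_p=n$, where $\mathcal{K}^{l}=\{(z_1,\dots,z_l)\in\mathbb{R}^l: z_1\ge (\sum_{j=2}^{l}z_j^2)^{1/2}\}$ for $l\ge 2$ and $\mathcal{K}^1=\{z\in\mathbb{R}:z\ge 0\}$. A vector $x\in\mathbb{R}^n$ is partitioned accordingly as $x=(x^1,\dots,x^p)$, $x^i\in\mathbb{R}^{n_i}$. Notation. $\|\cdot\|$ is the Euclidean norm. For $n_i\ge 2$ let $V_i=\{v\in\mathbb{R}^{n_i-1}:\|v\|\le 1\}$. For $E=\prod_i E_i$ with $E_i\subseteq V_i$, let $\mathcal{K}_E=\{x\in\mathbb{R}^n:(1,(v^i)^{\top})x^i\ge 0\ \text{for all } v^i\in E_i,\ i=1,\dots,p\}$; by convention, for blocks with $n_i=1$ the constraint is always just $x^i\ge 0$ (and the update of $E_i$ below is vacuous). Let $\bar A=\begin{pmatrix}c^{\top}\\ A\end{pmatrix}\in\mathbb{R}^{(1+m)\times n}$, $L=\{(\gamma,b):\gamma\in\mathbb{R}\}\subset\mathbb{R}^{1+m}$,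 and $\bar A\mathcal{K}_E=\{\bar Ax:x\in\mathcal{K}_E\}$. ALPN method. Choose finite sets $E_i^{(0)}\subseteq V_i$ such that the problem of maximizing $c^{\top}x$ subject to $Ax=b$, $x\in\mathcal{K}_{E^{(0)}}$ has an optimal solution, where $E^{(k)}=\prod_i E_i^{(k)}$. Choose $w^{(0)}=(\gamma^{(0)},b)\in L$ with $\gamma^{(0)}$ sufficiently large, meaning $\gamma^{(0)}>\max\{c^{\top}x:Ax=b,\ x\in\mathcal{K}_{E^{(0)}}\}$. For $k=0,1,2,\dots$: (1) Let $\bar w^{(k)}=(\zeta^{(k)},b^{(k)})\in\mathbb{R}\times\mathbb{R}^m$ be the point of $\bar A\mathcal{K}_{E^{(k)}}$ nearest to $w^{(k)}$, and take any $x^{(k)}\in\mathcal{K}_{E^{(k)}}$ with $\bar Ax^{(k)}=\bar w^{(k)}$. (2) If $x^{(k)}$ is feasible for (P), stop and return $x^{(k)}$. (3) Let $w^{(k+1)}=(\gamma^{(k+1)},b)$ be the intersection point of $L$ and $H^{(k)}$, where $H^{(k)}$ is the supporting hyperplane of $\bar A\mathcal{K}_{E^{(k)}}$ at $\bar w^{(k)}$ orthogonal to $w^{(k)}-\bar w^{(k)}$; equivalently $\gamma^{(k+1)}=\zeta^{(k)}-\|b-b^{(k)}\|^2/(\gamma^{(k)}-\zeta^{(k)})$. (4) For each $i$, choose $v^{i,(k)}\in\operatorname{argmin}_{v^i\in V_i}(1,(v^i)^{\top})x^{i,(k)}$ and set $E_i^{(k+1)}=E_i^{(k)}\cup\{v^{i,(k)}\}$,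 where $x^{i,(k)}$ is the $i$-th block of $x^{(k)}$. An infinite sequence generated by the method is one for which the stopping test in (2) never succeeds and step (3) is well defined for every $k$ (in particular $w^{(k)}\ne\bar w^{(k)}$). *)

theory Defs
  imports "HOL-Analysis.Analysis"
begin

text \<open>
  The partition \<open>x = (x\<^sup>1, \<dots>, x\<^sup>p)\<close> of a vector \<open>x :: real ^ 'n\<close> is given by two maps on the
  (arbitrary finite) index types: \<open>blk j\<close> is the number of the block that contains coordinate \<open>j\<close>,
  and \<open>lead i\<close> is the first coordinate of block \<open>i\<close>, so that \<open>blk (lead i) = i\<close>. The size
  \<open>n\<^sub>i \<ge> 1\<close> of block \<open>i\<close> is \<open>card {j. blk j = i}\<close>. Consecutive blocks of arbitrary sizes are an
  instance.
\<close>

definition block_partition :: "('n \<Rightarrow> 'p) \<Rightarrow> ('p \<Rightarrow> 'n) \<Rightarrow> bool" where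
  "block_partition blk lead \<longleftrightarrow> (\<forall>i. blk (lead i) = i)"

definition block_tail :: "('n \<Rightarrow> 'p) \<Rightarrow> ('p \<Rightarrow> 'n) \<Rightarrow> 'p \<Rightarrow> 'n set" where
  "block_tail blk lead i = {j. blk j = i \<and> j \<noteq> lead i}"

text \<open>If \<open>n\<^sub>i = 1\<close> the sum is empty and the condition on block \<open>i\<close> reads \<open>x $ lead i \<ge> 0\<close>.\<close>

definition soc_product ::
    "('n::finite \<Rightarrow> 'p::finite) \<Rightarrow> ('p \<Rightarrow> 'n) \<Rightarrow> (real ^ 'n) set" where
  "soc_product blk lead =
     {x. \<forall>i. x $ lead i \<ge> sqrt (\<Sum>j \<in> block_tail blk lead i. (x $ j)\<^sup>2)}"

text \<open>
  A vector \<open>v \<in> \<real>\<^bsup>n\<^sub>i - 1\<^esup>\<close> is represented by its extension by zero to a vector in \<open>real ^ 'n\<close> that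
  vanishes outside the tail of block \<open>i\<close>; this preserves the Euclidean norm.
\<close>

definition unit_ball_block ::
    "('n::finite \<Rightarrow> 'p::finite) \<Rightarrow> ('p \<Rightarrow> 'n) \<Rightarrow> 'p \<Rightarrow> (real ^ 'n) set" where
  "unit_ball_block blk lead i =
     {v. (\<forall>j. j \<notin> block_tail blk lead i \<longrightarrow> v $ j = 0) \<and> norm v \<le> 1}"

text \<open>The number \<open>(1, v\<^sup>T) x\<^sup>i\<close>:\<close>

definition cut_value ::
    "('n::finite \<Rightarrow> 'p::finite) \<Rightarrow> ('p \<Rightarrow> 'n) \<Rightarrow> 'p \<Rightarrow> real ^ 'n \<Rightarrow> real ^ 'n \<Rightarrow> real" where
  "cut_value blk lead i v x = x $ lead i + (\<Sum>j \<in> block_tail blk lead i. v $ j * x $ j)"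

text \<open>
  The product \<open>E = \<Prod>\<^sub>i E\<^sub>i\<close> is represented by the family of its factors. For blocks of size 1,
  \<open>unit_ball_block\<close> is \<open>{0}\<close> and the factor \<open>E i\<close> is ignored in the next definition.
\<close>

definition polyhedral_cone ::
    "('n::finite \<Rightarrow> 'p::finite) \<Rightarrow> ('p \<Rightarrow> 'n) \<Rightarrow> ('p \<Rightarrow> (real ^ 'n) set) \<Rightarrow> (real ^ 'n) set" where
  "polyhedral_cone blk lead E =
     {x. \<forall>i. if block_tail blk lead i = {} then x $ lead i \<ge> 0
             else (\<forall>v \<in> E i. cut_value blk lead i v x \<ge> 0)}"

definition feasible_set ::
    "real ^ 'n ^ 'm \<Rightarrow> real ^ 'm \<Rightarrow> (real ^ 'n) set \<Rightarrow> (real ^ 'n) set" where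
  "feasible_set A b K = {x \<in> K. A *v x = b}"

definition optimal_solutions ::
    "real ^ 'n ^ 'm \<Rightarrow> real ^ 'm \<Rightarrow> real ^ 'n \<Rightarrow> (real ^ 'n) set \<Rightarrow> (real ^ 'n) set" where
  "optimal_solutions A b c K =
     {x. is_arg_max (\<lambda>y. c \<bullet> y) (\<lambda>y. y \<in> feasible_set A b K) x}"

definition Abar ::
    "real ^ 'n ^ 'm \<Rightarrow> real ^ 'n \<Rightarrow> real ^ 'n \<Rightarrow> real \<times> (real ^ 'm)" where
  "Abar A c x = (c \<bullet> x, A *v x)"

definition target_line :: "real ^ 'm \<Rightarrow> (real \<times> (real ^ 'm)) set" where
  "target_line b = {(\<gamma>, b) |\<gamma>. True}"

definition orthogonal_hyperplane :: "'a::real_inner \<Rightarrow> 'a \<Rightarrow> 'a set" where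
  "orthogonal_hyperplane w z = {y. (w - z) \<bullet> (y - z) = 0}"

text \<open>
  An infinite run of the method. If \<open>w k \<noteq> wbar k\<close>, the set
  \<open>target_line b \<inter> orthogonal_hyperplane (w k) (wbar k)\<close> is a singleton if and only if
  \<open>fst (w k) \<noteq> fst (wbar k)\<close>, i.e. if and only if the update of \<open>w\<close> is well defined.
\<close>

definition alpn_run ::
    "('n::finite \<Rightarrow> 'p::finite) \<Rightarrow> ('p \<Rightarrow> 'n) \<Rightarrow>
     real ^ 'n ^ 'm \<Rightarrow> real ^ 'm \<Rightarrow> real ^ 'n \<Rightarrow>
     (nat \<Rightarrow> 'p \<Rightarrow> (real ^ 'n) set) \<Rightarrow>
     (nat \<Rightarrow> real \<times> (real ^ 'm)) \<Rightarrow> (nat \<Rightarrow> real \<times> (real ^ 'm)) \<Rightarrow>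
     (nat \<Rightarrow> 'p \<Rightarrow> real ^ 'n) \<Rightarrow> (nat \<Rightarrow> real ^ 'n) \<Rightarrow> bool" where
  "alpn_run blk lead A b c E w wbar v x \<longleftrightarrow>
     (\<forall>i. finite (E 0 i) \<and> E 0 i \<subseteq> unit_ball_block blk lead i) \<and>
     w 0 \<in> target_line b \<and>
     (\<exists>x0 \<in> optimal_solutions A b c (polyhedral_cone blk lead (E 0)). fst (w 0) > c \<bullet> x0) \<and>
     (\<forall>k.
        is_arg_min (dist (w k)) (\<lambda>y. y \<in> Abar A c ` polyhedral_cone blk lead (E k)) (wbar k) \<and>
        x k \<in> polyhedral_cone blk lead (E k) \<and>
        Abar A c (x k) = wbar k \<and>
        x k \<notin> feasible_set A b (soc_product blk lead) \<and>
        w k \<noteq> wbar k \<and>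
        target_line b \<inter> orthogonal_hyperplane (w k) (wbar k) = {w (Suc k)} \<and>
        (\<forall>i. is_arg_min (\<lambda>u. cut_value blk lead i u (x k))
                (\<lambda>u. u \<in> unit_ball_block blk lead i) (v k i) \<and>
             E (Suc k) i = E k i \<union> {v k i}))"

definition accumulation_point :: "(nat \<Rightarrow> 'a::topological_space) \<Rightarrow> 'a \<Rightarrow> bool" where
  "accumulation_point x a \<longleftrightarrow> (\<exists>r. strict_mono r \<and> (x \<circ> r) \<longlonglongrightarrow> a)"

end

theory Submission imports Defs begin

text \<open>
  Let \<open>\<theta>\<close> be the optimal value of (P). Since \<open>(\<theta>, b)\<close> lies in the convex cone \<open>Abar (K\<^sub>E)\<close>, the
  variational inequality for the nearest point gives
  \<open>\<theta> \<le> \<gamma>\<^bsub>k+1\<^esub> \<le> \<zeta>\<^sub>k < \<gamma>\<^sub>k\<close>. Hence \<open>\<gamma>\<^sub>k\<close> and \<open>\<zeta>\<^sub>k\<close> have a common limit \<open>\<ge> \<theta>\<close>, and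
  \<open>\<parallel>b - b\<^sub>k\<parallel>\<^sup>2 = (\<zeta>\<^sub>k - \<gamma>\<^bsub>k+1\<^esub>) (\<gamma>\<^sub>k - \<zeta>\<^sub>k)\<close> tends to \<open>0\<close>; so an accumulation point \<open>x\<^sup>*\<close> satisfies
  \<open>A x\<^sup>* = b\<close> and \<open>c \<bullet> x\<^sup>* \<ge> \<theta>\<close>. It lies in \<open>K\<close> because the deepest cuts chosen at \<open>x\<^sub>k\<close> are valid
  for all later iterates, hence for \<open>x\<^sup>*\<close>, and are uniformly Lipschitz.
\<close>

section \<open>The cone as the intersection of its cuts, and its relaxations\<close>

lemma cut_value_inner:
  assumes "u \<in> unit_ball_block blk lead i"
  shows "cut_value blk lead i u x = x $ lead i + u \<bullet> x"
proof -
  have "u \<bullet> x = (\<Sum>j\<in>block_tail blk lead i. u $ j * x $ j)"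
    unfolding inner_vec_def inner_real_def
    by (rule sum.mono_neutral_right) (use assms in \<open>auto simp: unit_ball_block_def\<close>)
  then show ?thesis
    by (simp add: cut_value_def)
qed

lemma zero_in_unit_ball_block: "0 \<in> unit_ball_block blk lead i"
  by (simp add: unit_ball_block_def)

text \<open>By Cauchy-Schwarz the least cut value over the ball of block \<open>i\<close> is the
  leading entry minus the norm of the tail.\<close>

lemma soc_product_iff_cuts:
  "x \<in> soc_product blk lead \<longleftrightarrow>
    (\<forall>i. \<forall>u \<in> unit_ball_block blk lead i. cut_value blk lead i u x \<ge> 0)"
proof -
  have "sqrt (\<Sum>j \<in> block_tail blk lead i. (x $ j)\<^sup>2) \<le> x $ lead i \<longleftrightarrow>
      (\<forall>u \<in> unit_ball_block blk lead i. cut_value blk lead i u x \<ge> 0)" for i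
  proof -
    \<comment> \<open>Extending the tail by zero turns the block sums into inner products on the
      whole space.\<close>
    define t where "t = (\<chi> j. if j \<in> block_tail blk lead i then x $ j else 0)"
    have "t \<bullet> t = (\<Sum>j \<in> block_tail blk lead i. (x $ j)\<^sup>2)"
      unfolding inner_vec_def inner_real_def t_def
      by (rule sum.mono_neutral_cong_right) (auto simp: power2_eq_square)
    then have norm_t: "sqrt (\<Sum>j \<in> block_tail blk lead i. (x $ j)\<^sup>2) = norm t"
      by (simp add: norm_eq_sqrt_inner)
    have cut: "cut_value blk lead i u x = x $ lead i + u \<bullet> t"
      if "u \<in> unit_ball_block blk lead i" for u
    proof -
      have "u \<bullet> x = u \<bullet> t"
        unfolding inner_vec_def t_def
        by (rule sum.cong) (use that in \<open>auto simp: unit_ball_block_def\<close>)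
      then show ?thesis
        by (simp add: cut_value_inner[OF that])
    qed
    \<comment> \<open>\<open>- sgn t\<close> attains the minimum; since \<open>sgn 0 = 0\<close>, it
      is in the ball for a zero tail too.\<close>
    have sgn_t: "- sgn t \<in> unit_ball_block blk lead i"
    proof -
      have "sgn t $ j = 0" if "j \<notin> block_tail blk lead i" for j
        using that by (simp add: sgn_div_norm t_def)
      then show ?thesis
        by (simp add: unit_ball_block_def norm_sgn)
    qed
    have "sgn t \<bullet> t = norm t"
      by (cases "t = 0") (simp_all add: sgn_div_norm dot_square_norm power2_eq_square)
    then have "cut_value blk lead i (- sgn t) x = x $ lead i - norm t"
      by (simp add: cut[OF sgn_t])
    moreover have "cut_value blk lead i u x \<ge> x $ lead i - norm t"
      if "u \<in> unit_ball_block blk lead i" for u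
    proof -
      have "\<bar>u \<bullet> t\<bar> \<le> norm u * norm t"
        by (rule Cauchy_Schwarz_ineq2)
      also have "\<dots> \<le> norm t"
        using that by (simp add: unit_ball_block_def mult_left_le_one_le)
      finally show ?thesis
        by (simp add: cut[OF that])
    qed
    ultimately show ?thesis
      unfolding norm_t using sgn_t by force
  qed
  then show ?thesis
    by (simp add: soc_product_def)
qed

lemma soc_product_subset_polyhedral_cone:
  assumes "\<And>i. E i \<subseteq> unit_ball_block blk lead i"
  shows "soc_product blk lead \<subseteq> polyhedral_cone blk lead E"
proof
  fix x assume x: "x \<in> soc_product blk lead"
  \<comment> \<open>The cut \<open>u = 0\<close> gives the constraint that the relaxation imposes on
    blocks of size 1.\<close>
  have "x $ lead i \<ge> 0" for i
    using x zero_in_unit_ball_block[of blk lead i]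
    by (fastforce simp: soc_product_iff_cuts cut_value_def)
  then show "x \<in> polyhedral_cone blk lead E"
    using x assms unfolding soc_product_iff_cuts polyhedral_cone_def by (simp add: subset_iff)
qed

lemma linear_cut_value: "linear (cut_value blk lead i u)"
  by (rule linearI)
    (simp_all add: cut_value_def algebra_simps sum.distrib sum_distrib_left)

lemma convex_polyhedral_cone: "convex (polyhedral_cone blk lead E)"
  unfolding convex_def polyhedral_cone_def
  by (auto simp: linear_add[OF linear_cut_value] linear_scale[OF linear_cut_value])

lemma linear_Abar: "linear (Abar A c)"
  by (rule linearI)
    (simp_all add: Abar_def inner_right_distrib matrix_vector_right_distrib
      matrix_vector_mult_scaleR)

section \<open>Nearest points and the scalar Newton step\<close>

text \<open>Otherwise a short step from \<open>z\<close> towards \<open>y\<close> would stay in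
  \<open>S\<close> by convexity and come closer to \<open>w\<close>.\<close>

lemma arg_min_dist_inner_le_zero:
  fixes S :: "'a::real_inner set"
  assumes "convex S" and "is_arg_min (dist w) (\<lambda>y. y \<in> S) z" and "y \<in> S"
  shows "(w - z) \<bullet> (y - z) \<le> 0"
proof (rule ccontr)
  assume "\<not> ?thesis"
  then obtain t where "0 < t" "t \<le> 1" and closer: "dist (z + t *\<^sub>R (y - z)) w < dist z w"
    using closer_point_lemma[of w z y] by auto
  have "z \<in> S"
    using assms(2) by (simp add: is_arg_min_def)
  have "z + t *\<^sub>R (y - z) = (1 - t) *\<^sub>R z + t *\<^sub>R y"
    by (simp add: algebra_simps)
  also have "\<dots> \<in> S"
    using assms(1,3) \<open>z \<in> S\<close> \<open>0 < t\<close> \<open>t \<le> 1\<close> by (simp add: convexD)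
  finally show False
    using closer assms(2) by (metis is_arg_min_def dist_commute)
qed

text \<open>Here \<open>s\<close> stands for the squared residual of the equality constraints.
  \<open>cut\<close> is the variational inequality tested at \<open>(\<theta>, b)\<close>, and
  \<open>step\<close> says that the next point lies on the hyperplane; comparing the two yields the
  last bound.\<close>

lemma newton_step_bounds:
  fixes \<gamma> \<gamma>' \<zeta> \<theta> s :: real
  assumes "\<theta> \<le> \<gamma>" and "0 \<le> s" and "\<gamma> = \<zeta> \<Longrightarrow> s \<noteq> 0"
    and cut: "(\<gamma> - \<zeta>) * (\<theta> - \<zeta>) + s \<le> 0"
    and step: "(\<gamma> - \<zeta>) * (\<gamma>' - \<zeta>) + s = 0"
  shows "\<zeta> < \<gamma>" "\<gamma>' \<le> \<zeta>" "\<theta> \<le> \<gamma>'"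
proof -
  have "\<gamma> \<noteq> \<zeta>"
    using assms(3) step by auto
  moreover have "\<not> \<gamma> < \<zeta>"
  proof
    \<comment> \<open>Then \<theta> also lies below \<zeta>, so both factors in \<open>cut\<close>
      are negative.\<close>
    assume "\<gamma> < \<zeta>"
    then have "(\<gamma> - \<zeta>) * (\<theta> - \<zeta>) > 0"
      using assms(1) by (intro mult_neg_neg) auto
    then show False
      using cut assms(2) by simp
  qed
  ultimately show pos: "\<zeta> < \<gamma>"
    by simp
  have "(\<gamma> - \<zeta>) * (\<gamma>' - \<zeta>) \<le> 0"
    using step assms(2) by simp
  then show "\<gamma>' \<le> \<zeta>"
    using pos by (simp add: mult_le_0_iff)
  have "(\<gamma> - \<zeta>) * (\<theta> - \<zeta>) \<le> (\<gamma> - \<zeta>) * (\<gamma>' - \<zeta>)"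
    using step cut by simp
  then show "\<theta> \<le> \<gamma>'"
    using pos by simp
qed

section \<open>Cuts along a run and feasibility for the cone\<close>

context
  fixes blk :: "'n::finite \<Rightarrow> 'p::finite" and lead :: "'p \<Rightarrow> 'n"
    and A :: "real ^ 'n ^ 'm" and b :: "real ^ 'm" and c :: "real ^ 'n"
    and E :: "nat \<Rightarrow> 'p \<Rightarrow> (real ^ 'n) set"
    and w wbar :: "nat \<Rightarrow> real \<times> (real ^ 'm)"
    and v :: "nat \<Rightarrow> 'p \<Rightarrow> real ^ 'n"
    and x :: "nat \<Rightarrow> real ^ 'n"
  assumes run: "alpn_run blk lead A b c E w wbar v x"
begin

lemma alpn_cut_in_unit_ball_block: "v k i \<in> unit_ball_block blk lead i"
  using run by (auto simp: alpn_run_def is_arg_min_def)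

lemma alpn_cut_minimal:
  assumes "u \<in> unit_ball_block blk lead i"
  shows "cut_value blk lead i (v k i) (x k) \<le> cut_value blk lead i u (x k)"
proof -
  have "is_arg_min (\<lambda>u. cut_value blk lead i u (x k)) (\<lambda>u. u \<in> unit_ball_block blk lead i) (v k i)"
    using run by (simp add: alpn_run_def)
  then show ?thesis
    using assms by (auto simp: is_arg_min_linorder)
qed

lemma alpn_cuts_Suc: "E (Suc k) i = insert (v k i) (E k i)"
  using run by (simp add: alpn_run_def)

lemma alpn_cuts_subset: "E k i \<subseteq> unit_ball_block blk lead i"
proof (induction k)
  case 0
  show ?case
    using run by (simp add: alpn_run_def)
next
  case (Suc k)
  then show ?case
    by (simp add: alpn_cuts_Suc alpn_cut_in_unit_ball_block)
qed

lemma alpn_relaxation: "soc_product blk lead \<subseteq> polyhedral_cone blk lead (E k)"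
  by (rule soc_product_subset_polyhedral_cone) (rule alpn_cuts_subset)

text \<open>The inequality is strict because \<open>v k i\<close> first enters at
  \<open>E (Suc k)\<close>. On a block of size 1 the cut value is just the leading entry.\<close>

lemma alpn_earlier_cut:
  assumes "k < l"
  shows "cut_value blk lead i (v k i) (x l) \<ge> 0"
proof -
  have "E (Suc k) i \<subseteq> E l i"
    by (rule lift_Suc_mono_le[of "\<lambda>k. E k i"]) (use assms in \<open>auto simp: alpn_cuts_Suc\<close>)
  then have "v k i \<in> E l i"
    by (simp add: alpn_cuts_Suc)
  moreover have "x l \<in> polyhedral_cone blk lead (E l)"
    using run by (simp add: alpn_run_def)
  ultimately show ?thesis
    by (cases "block_tail blk lead i = {}") (auto simp: polyhedral_cone_def cut_value_def
      split: if_splits dest!: spec[of _ i])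
qed

lemma alpn_limit_in_soc_product:
  assumes r: "strict_mono r" and lim: "(x \<circ> r) \<longlonglongrightarrow> a"
  shows "a \<in> soc_product blk lead"
  unfolding soc_product_iff_cuts
proof (intro allI ballI)
  fix i u assume u: "u \<in> unit_ball_block blk lead i"
  have tendsto_cut: "(\<lambda>m. cut_value blk lead i u' (x (r m))) \<longlonglongrightarrow> cut_value blk lead i u' a" for u'
    using lim unfolding cut_value_def comp_def by (intro tendsto_intros)
  \<comment> \<open>For fixed \<open>k\<close>, \<open>r m\<close> eventually exceeds
    \<open>k\<close>, and nonnegativity passes to the limit.\<close>
  have limit_cut: "cut_value blk lead i (v k i) a \<ge> 0" for k
  proof (rule tendsto_lowerbound[OF tendsto_cut])
    show "\<forall>\<^sub>F m in sequentially. 0 \<le> cut_value blk lead i (v k i) (x (r m))"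
      using eventually_gt_at_top[of k]
      by eventually_elim (metis alpn_earlier_cut seq_suble[OF r] less_le_trans)
  qed simp
  \<comment> \<open>One norm pays for the inner product with the cut and one for the leading entry.
    As all cuts lie in the unit ball, the constant 2 serves every \<open>k\<close>.\<close>
  have bound: "- (2 * norm (x k - a)) \<le> cut_value blk lead i u (x k)" for k
  proof -
    let ?v = "v k i" and ?d = "x k - a"
    note V = alpn_cut_in_unit_ball_block[of k i]
    have "\<bar>?v \<bullet> ?d\<bar> \<le> norm ?v * norm ?d"
      by (rule Cauchy_Schwarz_ineq2)
    also have "\<dots> \<le> norm ?d"
      using V by (simp add: unit_ball_block_def mult_left_le_one_le)
    finally have "\<bar>?v \<bullet> ?d\<bar> \<le> norm ?d" .
    moreover have "\<bar>?d $ lead i\<bar> \<le> norm ?d"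
      by (rule component_le_norm_cart)
    ultimately have "- (2 * norm ?d) \<le> cut_value blk lead i ?v ?d"
      unfolding cut_value_inner[OF V] by linarith
    also have "\<dots> = cut_value blk lead i ?v (x k) - cut_value blk lead i ?v a"
      by (rule linear_diff[OF linear_cut_value])
    \<comment> \<open>The cut is nonnegative at \<open>a\<close> and is the deepest one at
      \<open>x k\<close>.\<close>
    also have "\<dots> \<le> cut_value blk lead i u (x k)"
      using limit_cut[of k] alpn_cut_minimal[OF u, of k] by simp
    finally show ?thesis .
  qed
  have "(\<lambda>m. - (2 * norm (x (r m) - a))) \<longlonglongrightarrow> - (2 * norm (a - a))"
    using lim unfolding comp_def by (intro tendsto_intros)
  then have "(\<lambda>m. - (2 * norm (x (r m) - a))) \<longlonglongrightarrow> 0"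
    by simp
  then show "0 \<le> cut_value blk lead i u a"
    by (rule tendsto_le[OF sequentially_bot tendsto_cut]) (simp add: bound)
qed

section \<open>Monotone values and convergence of the projections\<close>

lemma alpn_target_line: "snd (w k) = b"
proof (cases k)
  case 0
  then show ?thesis
    using run by (auto simp: alpn_run_def target_line_def)
next
  case (Suc l)
  have "target_line b \<inter> orthogonal_hyperplane (w l) (wbar l) = {w (Suc l)}"
    using run by (simp add: alpn_run_def)
  then have "w (Suc l) \<in> target_line b"
    by blast
  then show ?thesis
    by (auto simp: Suc target_line_def)
qed

lemma alpn_newton_equation:
  "(fst (w k) - fst (wbar k)) * (fst (w (Suc k)) - fst (wbar k)) + (norm (b - snd (wbar k)))\<^sup>2 = 0"
proof -
  have "target_line b \<inter> orthogonal_hyperplane (w k) (wbar k) = {w (Suc k)}"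
    using run by (simp add: alpn_run_def)
  then have "w (Suc k) \<in> orthogonal_hyperplane (w k) (wbar k)"
    by blast
  then show ?thesis
    by (simp add: orthogonal_hyperplane_def inner_prod_def alpn_target_line power2_norm_eq_inner)
qed

lemma alpn_step_bounds:
  assumes z: "z \<in> feasible_set A b (soc_product blk lead)" and le: "c \<bullet> z \<le> fst (w k)"
  shows "fst (wbar k) < fst (w k)" "fst (w (Suc k)) \<le> fst (wbar k)" "c \<bullet> z \<le> fst (w (Suc k))"
proof -
  let ?S = "Abar A c ` polyhedral_cone blk lead (E k)"
  have "z \<in> polyhedral_cone blk lead (E k)"
    using z alpn_relaxation
    by (auto simp: feasible_set_def)
  moreover have "Abar A c z = (c \<bullet> z, b)"
    using z by (simp add: feasible_set_def Abar_def)
  ultimately have mem: "(c \<bullet> z, b) \<in> ?S"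
    by (metis imageI)
  have "is_arg_min (dist (w k)) (\<lambda>y. y \<in> ?S) (wbar k)"
    using run by (simp add: alpn_run_def)
  then have "(w k - wbar k) \<bullet> ((c \<bullet> z, b) - wbar k) \<le> 0"
    by (intro arg_min_dist_inner_le_zero[OF _ _ mem] convex_linear_image linear_Abar
      convex_polyhedral_cone)
  then have cut: "(fst (w k) - fst (wbar k)) * (c \<bullet> z - fst (wbar k))
      + (norm (b - snd (wbar k)))\<^sup>2 \<le> 0"
    by (simp add: inner_prod_def alpn_target_line power2_norm_eq_inner)
  have "w k \<noteq> wbar k"
    using run by (simp add: alpn_run_def)
  \<comment> \<open>Both second components would have to be \<open>b\<close> if the residual
    vanished, making the two points equal.\<close>
  then have neq: "(norm (b - snd (wbar k)))\<^sup>2 \<noteq> 0" if "fst (w k) = fst (wbar k)"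
    using that by (auto simp: prod_eq_iff alpn_target_line)
  note bounds = newton_step_bounds[OF le zero_le_power2 neq cut alpn_newton_equation]
  show "fst (wbar k) < fst (w k)" "fst (w (Suc k)) \<le> fst (wbar k)" "c \<bullet> z \<le> fst (w (Suc k))"
    using bounds by blast+
qed

text \<open>The start value exceeds the optimum of the first relaxation, which contains the feasible
  set of (P); each Newton step preserves the bound.\<close>

lemma alpn_value_bound:
  assumes "z \<in> feasible_set A b (soc_product blk lead)"
  shows "c \<bullet> z \<le> fst (w k)"
proof (induction k)
  case 0
  obtain x0 where x0: "x0 \<in> optimal_solutions A b c (polyhedral_cone blk lead (E 0))"
    and "c \<bullet> x0 < fst (w 0)"
    using run by (auto simp: alpn_run_def)
  moreover have "z \<in> feasible_set A b (polyhedral_cone blk lead (E 0))"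
    using assms alpn_relaxation
    by (auto simp: feasible_set_def)
  ultimately show ?case
    by (force simp: optimal_solutions_def is_arg_max_linorder)
next
  case (Suc k)
  then show ?case
    using alpn_step_bounds(3)[OF assms] by blast
qed

lemma alpn_wbar_converges:
  assumes z: "z \<in> feasible_set A b (soc_product blk lead)"
  obtains \<gamma> where "c \<bullet> z \<le> \<gamma>" "wbar \<longlonglongrightarrow> (\<gamma>, b)"
proof -
  note step = alpn_step_bounds[OF z alpn_value_bound[OF z]]
  have "decseq (\<lambda>k. fst (w k))"
    unfolding decseq_Suc_iff by (meson step less_imp_le order_trans)
  then obtain \<gamma> where \<gamma>: "(\<lambda>k. fst (w k)) \<longlonglongrightarrow> \<gamma>" and "c \<bullet> z \<le> \<gamma>"
    by (metis decseq_convergent[of _ "c \<bullet> z"] alpn_value_bound[OF z] LIMSEQ_le_const)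
  have \<gamma>_Suc: "(\<lambda>k. fst (w (Suc k))) \<longlonglongrightarrow> \<gamma>"
    using \<gamma> by (rule LIMSEQ_Suc)
  have \<zeta>: "(\<lambda>k. fst (wbar k)) \<longlonglongrightarrow> \<gamma>"
    by (rule tendsto_sandwich[OF _ _ \<gamma>_Suc \<gamma>])
      (intro always_eventually allI step less_imp_le)+
  \<comment> \<open>The Newton equation factors the squared residual into two gaps, each tending to
    0.\<close>
  have "(norm (b - snd (wbar k)))\<^sup>2
      = (fst (w k) - fst (wbar k)) * (fst (wbar k) - fst (w (Suc k)))" for k
    using alpn_newton_equation[of k] by (simp add: algebra_simps)
  moreover have "(\<lambda>k. (fst (w k) - fst (wbar k)) * (fst (wbar k) - fst (w (Suc k))))
      \<longlonglongrightarrow> (\<gamma> - \<gamma>) * (\<gamma> - \<gamma>)"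
    by (intro tendsto_intros \<gamma> \<gamma>_Suc \<zeta>)
  ultimately have "(\<lambda>k. (norm (b - snd (wbar k)))\<^sup>2) \<longlonglongrightarrow> 0"
    by simp
  then have "(\<lambda>k. b - snd (wbar k)) \<longlonglongrightarrow> 0"
    by (simp add: tendsto_norm_zero_iff)
  then have "(\<lambda>k. b - (b - snd (wbar k))) \<longlonglongrightarrow> b - 0"
    by (intro tendsto_intros)
  then have "(\<lambda>k. snd (wbar k)) \<longlonglongrightarrow> b"
    by simp
  then have "wbar \<longlonglongrightarrow> (\<gamma>, b)"
    using tendsto_Pair[OF \<zeta>] by fastforce
  with \<open>c \<bullet> z \<le> \<gamma>\<close> show ?thesis
    by (rule that)
qed

end

theorem theorem1:
  fixes blk :: "'n::finite \<Rightarrow> 'p::finite" and lead :: "'p \<Rightarrow> 'n"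
    and A :: "real ^ 'n ^ 'm" and b :: "real ^ 'm" and c :: "real ^ 'n"
    and E :: "nat \<Rightarrow> 'p \<Rightarrow> (real ^ 'n) set"
    and w wbar :: "nat \<Rightarrow> real \<times> (real ^ 'm)"
    and v :: "nat \<Rightarrow> 'p \<Rightarrow> real ^ 'n"
    and x :: "nat \<Rightarrow> real ^ 'n" and xstar :: "real ^ 'n"
  assumes "block_partition blk lead"
    and "optimal_solutions A b c (soc_product blk lead) \<noteq> {}"
    and "compact (optimal_solutions A b c (soc_product blk lead))"
    and "alpn_run blk lead A b c E w wbar v x"
    and "accumulation_point x xstar"
  shows "xstar \<in> optimal_solutions A b c (soc_product blk lead)"
proof -
  note run = \<open>alpn_run blk lead A b c E w wbar v x\<close>
  obtain r where r: "strict_mono r" and lim: "(x \<circ> r) \<longlonglongrightarrow> xstar"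
    using assms(5) by (auto simp: accumulation_point_def)
  obtain z where z: "z \<in> feasible_set A b (soc_product blk lead)"
    and max: "\<And>y. y \<in> feasible_set A b (soc_product blk lead) \<Longrightarrow> c \<bullet> y \<le> c \<bullet> z"
    using assms(2) by (auto simp: optimal_solutions_def is_arg_max_linorder)
  obtain \<gamma> where \<gamma>: "c \<bullet> z \<le> \<gamma>" and wbar: "wbar \<longlonglongrightarrow> (\<gamma>, b)"
    by (rule alpn_wbar_converges[OF run z])
  \<comment> \<open>Continuity of \<open>Abar\<close> identifies its value at \<open>xstar\<close>
    with the limit of the projections, giving the equality constraints and the objective value at
    once.\<close>
  have "(\<lambda>k. Abar A c ((x \<circ> r) k)) \<longlonglongrightarrow> Abar A c xstar"
    by (rule bounded_linear.tendsto[OF _ lim]) (simp add: linear_Abar flip: linear_conv_bounded_linear)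
  moreover have "(\<lambda>k. Abar A c ((x \<circ> r) k)) = wbar \<circ> r"
    using run by (auto simp: alpn_run_def)
  ultimately have "Abar A c xstar = (\<gamma>, b)"
    using LIMSEQ_subseq_LIMSEQ[OF wbar r] LIMSEQ_unique by metis
  then have "A *v xstar = b" "c \<bullet> xstar = \<gamma>"
    by (simp_all add: Abar_def)
  then have "xstar \<in> feasible_set A b (soc_product blk lead)"
    using alpn_limit_in_soc_product[OF run r lim] by (simp add: feasible_set_def)
  moreover have "c \<bullet> y \<le> c \<bullet> xstar" if "y \<in> feasible_set A b (soc_product blk lead)" for y
    using max[OF that] \<gamma> \<open>c \<bullet> xstar = \<gamma>\<close> by simp
  ultimately show ?thesis
    by (simp add: optimal_solutions_def is_arg_max_linorder)
qed

end
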